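(* Let $x_1,\dots,x_n\in\mathbb{R}$ be pairwise distinct and let $Y$ be a centered Gaussian process on $\mathbb{R}$ with exponential covariance function $k(t_1,t_2)=\sigma^2\exp(-|t_1-t_2|/\theta)$, $t_1,t_2\in\mathbb{R}$, for fixed $(\sigma^2,\theta)\in(0,\infty)^2$. Let $X_1,\dots,X_p$ be a partition of $\{x_1,\dots,x_n\}$ into non-empty groups. Let $M_{full}(x)$ be the full Kriging predictor of $Y(x)$ based on $Y(x_1),\dots,Y(x_n)$, and let $M_{\mathcal{A}}(x)$ be the nested Kriging predictor aggregating the Gaussian process predictors $M_1,\dots,M_p$ based on the individual groups $X_1,\dots,X_p$. Then $\mathrm{E}[(M_{full}(x)-M_{\mathcal{A}}(x))^2]=0$ for all $x\in\mathbb{R}$ if and only if $X_1,\dots,X_p$ is a perfect clustering.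
   Context: Perfect clustering: a partition $X_1,\dots,X_p$ of $\{x_1,\dots,x_n\}$ composed of non-empty groups is a perfect clustering if there does not exist any triplet $u,v,w$ with $u,v\in X_i$ and $w\in X_j$, $i,j\in\{1,\dots,p\}$, $i\ne j$, such that $u<w<v$. Notation: with $X=(x_1,\dots,x_n)^t$, $M_{full}(x)=\mathrm{E}[Y(x)\mid Y(X)]=k(x,X)k(X,X)^{-1}Y(X)$, where $k(A,B)$ is the matrix with entries $k(a_i,b_j)$ and $Y(A)$ the vector with entries $Y(a_i)$. For each $i$, $M_i(x)=k(x,X_i)k(X_i,X_i)^{-1}Y(X_i)$ (the elements of $X_i$ being arranged in a vector). With $M(x)=(M_1(x),\dots,M_p(x))^t$, $K_M(x)$ its covariance matrix and $k_M(x)$ the vector with entries $\mathrm{Cov}[M_i(x),Y(x)]$, the nested Kriging predictor is $M_{\mathcal{A}}(x)=k_M(x)^tK_M(x)^{-1}M(x)$, the best linear predictor of $Y(x)$ from $M_1(x),\dots,M_p(x)$. *)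

theory Defs
  imports
    "HOL-Probability.Probability"
    "Jordan_Normal_Form.Gauss_Jordan_Elimination"
begin

(* Possibly degenerate real Gaussian random variable: point masses count as Gaussian. *)
definition gaussian_rv :: "'a measure \<Rightarrow> ('a \<Rightarrow> real) \<Rightarrow> bool" where
  "gaussian_rv M Z \<longleftrightarrow> Z \<in> borel_measurable M \<and>
     ((\<exists>\<mu> s. 0 < s \<and> distributed M lborel Z (normal_density \<mu> s)) \<or>
      (\<exists>c. AE \<omega> in M. Z \<omega> = c))"

definition gaussian_process :: "'a measure \<Rightarrow> 't set \<Rightarrow> ('t \<Rightarrow> 'a \<Rightarrow> real) \<Rightarrow> bool" where
  "gaussian_process M T Y \<longleftrightarrow> prob_space M \<and>
     (\<forall>t\<in>T. Y t \<in> borel_measurable M) \<and>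
     (\<forall>S c. finite S \<longrightarrow> S \<subseteq> T \<longrightarrow> gaussian_rv M (\<lambda>\<omega>. \<Sum>t\<in>S. c t * Y t \<omega>))"

definition covariance :: "'a measure \<Rightarrow> ('a \<Rightarrow> real) \<Rightarrow> ('a \<Rightarrow> real) \<Rightarrow> real" where
  "covariance M U V =
     (LINT \<omega>|M. (U \<omega> - (LINT \<omega>'|M. U \<omega>')) * (V \<omega> - (LINT \<omega>'|M. V \<omega>')))"

definition centered_gaussian_process ::
  "'a measure \<Rightarrow> 't set \<Rightarrow> ('t \<Rightarrow> 't \<Rightarrow> real) \<Rightarrow> ('t \<Rightarrow> 'a \<Rightarrow> real) \<Rightarrow> bool" where
  "centered_gaussian_process M T k Y \<longleftrightarrow> gaussian_process M T Y \<and>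
     (\<forall>t\<in>T. (LINT \<omega>|M. Y t \<omega>) = 0) \<and>
     (\<forall>s\<in>T. \<forall>t\<in>T. covariance M (Y s) (Y t) = k s t)"

definition exp_cov :: "real \<Rightarrow> real \<Rightarrow> real \<Rightarrow> real \<Rightarrow> real" where
  "exp_cov \<sigma>2 \<theta> t1 t2 = \<sigma>2 * exp (- \<bar>t1 - t2\<bar> / \<theta>)"

definition cov_mat :: "('t \<Rightarrow> 't \<Rightarrow> real) \<Rightarrow> 't list \<Rightarrow> 't list \<Rightarrow> real mat" where
  "cov_mat k A B = Matrix.mat (length A) (length B) (\<lambda>(i, j). k (A ! i) (B ! j))"

(* The row vector k(x,A). *)
definition cov_vec :: "('t \<Rightarrow> 't \<Rightarrow> real) \<Rightarrow> 't \<Rightarrow> 't list \<Rightarrow> real Matrix.vec" where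
  "cov_vec k x A = Matrix.row (cov_mat k [x] A) 0"

(* Unspecified for singular matrices. *)
definition inv_mat :: "real mat \<Rightarrow> real mat" where
  "inv_mat A = the (mat_inverse A)"

definition obs_vec :: "('t \<Rightarrow> 'a \<Rightarrow> real) \<Rightarrow> 't list \<Rightarrow> 'a \<Rightarrow> real Matrix.vec" where
  "obs_vec Y A \<omega> = Matrix.vec (length A) (\<lambda>i. Y (A ! i) \<omega>)"

(* k(x,A) k(A,A)^{-1} Y(A), which is the version of E[Y(x) | Y(A)] used throughout. *)
definition kriging ::
  "('t \<Rightarrow> 't \<Rightarrow> real) \<Rightarrow> ('t \<Rightarrow> 'a \<Rightarrow> real) \<Rightarrow> 't list \<Rightarrow> 't \<Rightarrow> 'a \<Rightarrow> real" where
  "kriging k Y A x \<omega> =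
     Matrix.scalar_prod (cov_vec k x A) (inv_mat (cov_mat k A A) *\<^sub>v obs_vec Y A \<omega>)"

(* Best linear aggregation k_M(x)^t K_M(x)^{-1} M(x) of predictors m 0 x, ..., m (p-1) x. *)
definition aggregate ::
  "'a measure \<Rightarrow> ('t \<Rightarrow> 'a \<Rightarrow> real) \<Rightarrow> nat \<Rightarrow> (nat \<Rightarrow> 't \<Rightarrow> 'a \<Rightarrow> real) \<Rightarrow> 't \<Rightarrow> 'a \<Rightarrow> real" where
  "aggregate M Y p m x \<omega> =
     Matrix.scalar_prod
       (Matrix.vec p (\<lambda>i. covariance M (m i x) (Y x)))
       (inv_mat (Matrix.mat p p (\<lambda>(i, j). covariance M (m i x) (m j x)))
          *\<^sub>v Matrix.vec p (\<lambda>i. m i x \<omega>))"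

definition nested_kriging ::
  "'a measure \<Rightarrow> ('t \<Rightarrow> 't \<Rightarrow> real) \<Rightarrow> ('t \<Rightarrow> 'a \<Rightarrow> real) \<Rightarrow> nat \<Rightarrow> (nat \<Rightarrow> 't list) \<Rightarrow>
     't \<Rightarrow> 'a \<Rightarrow> real" where
  "nested_kriging M k Y p A = aggregate M Y p (\<lambda>i. kriging k Y (A i))"

(* Groups are X 0, ..., X (p-1). That they form a partition into non-empty groups
   is not part of this predicate. *)
definition perfect_clustering :: "nat \<Rightarrow> (nat \<Rightarrow> real set) \<Rightarrow> bool" where
  "perfect_clustering p X \<longleftrightarrow>
     \<not> (\<exists>i\<in>{..<p}. \<exists>j\<in>{..<p}. i \<noteq> j \<and>
          (\<exists>u\<in>X i. \<exists>v\<in>X i. \<exists>w\<in>X j. u < w \<and> w < v))"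

end

theory Submission
  imports Defs "Jordan_Normal_Form.Determinant"
begin

text \<open>
  Since \<open>k\<close> is strictly positive definite, \<open>Y(x\<^sub>1), \<dots>, Y(x\<^sub>n)\<close> are linearly independent, so
  the nested and the full predictor agree at \<open>t\<close> iff the full Kriging weights, restricted to each
  group, are proportional to the weights within that group. The exponential covariance is Markov:
  a Kriging predictor only uses the neighbours of \<open>t\<close>. In a perfect clustering the neighbours
  of \<open>t\<close> either lie in one group, whose predictor is then the full one, or in two groups lying
  on opposite sides of \<open>t\<close>, each of which predicts from its neighbour alone. Conversely, let
  \<open>u < v\<close> be consecutive in their group but \<open>b\<close> be the successor of \<open>u\<close> in all of \<open>X\<close>, \<open>b < v\<close>.
  Between \<open>u\<close> and \<open>b\<close> the full weights are positive at \<open>u\<close> and zero at \<open>v\<close>, whereas the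
  group weights are positive at both.
\<close>

section \<open>Inverses of nonsingular matrices and linear systems\<close>

text \<open>A zero determinant would give a nonzero kernel vector, which \<open>inj\<close> forbids.
  Hence \<open>mat_inverse\<close> returns \<open>Some\<close>, and the unspecified case of
  \<open>inv_mat\<close> never arises.\<close>

lemma inv_mat_nonsingular:
  fixes K :: "nat \<Rightarrow> nat \<Rightarrow> real"
  assumes inj: "\<And>c. \<forall>i<n. (\<Sum>j<n. K i j * c j) = 0 \<Longrightarrow> \<forall>i<n. c i = 0"
  defines "Km \<equiv> Matrix.mat n n (\<lambda>(i, j). K i j)"
  shows "inv_mat Km \<in> carrier_mat n n" and "Km * inv_mat Km = 1\<^sub>m n"
proof -
  have Km: "Km \<in> carrier_mat n n" by (simp add: Km_def)
  have "Determinant.det Km \<noteq> 0"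
  proof
    assume "Determinant.det Km = 0"
    then obtain v where v: "v \<in> carrier_vec n" "v \<noteq> 0\<^sub>v n" "Km *\<^sub>v v = 0\<^sub>v n"
      using det_0_iff_vec_prod_zero_field[OF Km] by blast
    have "(\<Sum>j<n. K i j * vec_index v j) = 0" if "i < n" for i
    proof -
      have "vec_index (Km *\<^sub>v v) i = (\<Sum>j<n. K i j * vec_index v j)"
        using that v(1) by (simp add: Km_def scalar_prod_def lessThan_atLeast0)
      then show ?thesis using v(3) that by simp
    qed
    then have "\<forall>i<n. vec_index v i = 0" using inj by blast
    then have "v = 0\<^sub>v n" using v(1) by (intro eq_vecI) auto
    with v(2) show False by simp
  qed
  then have "Km \<in> Units (ring_mat TYPE(real) n ())"
    by (rule det_non_zero_imp_unit[OF Km])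
  then obtain B where "mat_inverse Km = Some B"
    using mat_inverse(1)[OF Km, of "()"] by (cases "mat_inverse Km") auto
  then show "inv_mat Km \<in> carrier_mat n n" "Km * inv_mat Km = 1\<^sub>m n"
    using mat_inverse(2)[OF Km] by (auto simp: inv_mat_def)
qed

lemma sum_mult_inv_mat_vec:
  fixes K :: "nat \<Rightarrow> nat \<Rightarrow> real" and y :: "nat \<Rightarrow> real"
  assumes inj: "\<And>c. \<forall>i<n. (\<Sum>j<n. K i j * c j) = 0 \<Longrightarrow> \<forall>i<n. c i = 0"
  defines "z \<equiv> inv_mat (Matrix.mat n n (\<lambda>(i, j). K i j)) *\<^sub>v Matrix.vec n y"
  shows "z \<in> carrier_vec n" and "i < n \<Longrightarrow> (\<Sum>j<n. K i j * vec_index z j) = y i"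
proof -
  define Km where "Km = Matrix.mat n n (\<lambda>(i, j). K i j)"
  have Km: "Km \<in> carrier_mat n n" by (simp add: Km_def)
  have N: "inv_mat Km \<in> carrier_mat n n" "Km * inv_mat Km = 1\<^sub>m n"
    unfolding Km_def using inv_mat_nonsingular[of n K] inj by blast+
  have z_eq: "z = inv_mat Km *\<^sub>v Matrix.vec n y" by (simp add: z_def Km_def)
  show z: "z \<in> carrier_vec n" using N by (simp add: z_eq)
  have "Km *\<^sub>v z = (Km * inv_mat Km) *\<^sub>v Matrix.vec n y"
    unfolding z_eq by (rule assoc_mult_mat_vec[symmetric, OF Km N(1)]) simp
  then have "Km *\<^sub>v z = Matrix.vec n y" by (simp add: N(2))
  moreover have "vec_index (Km *\<^sub>v z) i = (\<Sum>j<n. K i j * vec_index z j)" if "i < n"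
    using that z by (simp add: Km_def scalar_prod_def lessThan_atLeast0)
  ultimately show "(\<Sum>j<n. K i j * vec_index z j) = y i" if "i < n"
    using that by (metis index_vec)
qed

lemma nonsingular_solvable:
  fixes K :: "nat \<Rightarrow> nat \<Rightarrow> real"
  assumes inj: "\<And>c. \<forall>i<n. (\<Sum>j<n. K i j * c j) = 0 \<Longrightarrow> \<forall>i<n. c i = 0"
  shows "\<exists>c. \<forall>i<n. (\<Sum>j<n. K i j * c j) = b i"
  using sum_mult_inv_mat_vec(2)[of n K _ b, OF inj] by blast

text \<open>By symmetry the inverse can be moved from \<open>y\<close> to \<open>b\<close>, so any
  solution \<open>c\<close> of the linear system gives the value. This serves both the Kriging
  predictors and their aggregation.\<close>

lemma scalar_prod_inv_mat:
  fixes K :: "nat \<Rightarrow> nat \<Rightarrow> real"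
  assumes inj: "\<And>c. \<forall>i<n. (\<Sum>j<n. K i j * c j) = 0 \<Longrightarrow> \<forall>i<n. c i = 0"
    and sym: "\<And>i j. i < n \<Longrightarrow> j < n \<Longrightarrow> K i j = K j i"
    and c: "\<And>i. i < n \<Longrightarrow> (\<Sum>j<n. K i j * c j) = b i"
  shows "Matrix.scalar_prod (Matrix.vec n b)
      (inv_mat (Matrix.mat n n (\<lambda>(i, j). K i j)) *\<^sub>v Matrix.vec n y) = (\<Sum>i<n. c i * y i)"
proof -
  define z where "z = inv_mat (Matrix.mat n n (\<lambda>(i, j). K i j)) *\<^sub>v Matrix.vec n y"
  have z: "z \<in> carrier_vec n" and y: "i < n \<Longrightarrow> (\<Sum>j<n. K i j * vec_index z j) = y i" for i
    unfolding z_def using sum_mult_inv_mat_vec[of n K, OF inj] by blast+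
  have "Matrix.scalar_prod (Matrix.vec n b) z = (\<Sum>i<n. b i * vec_index z i)"
    using z by (simp add: scalar_prod_def lessThan_atLeast0)
  also have "\<dots> = (\<Sum>i<n. \<Sum>j<n. K i j * c j * vec_index z i)"
    by (intro sum.cong) (simp_all add: c[symmetric] sum_distrib_right)
  also have "\<dots> = (\<Sum>j<n. \<Sum>i<n. K i j * c j * vec_index z i)"
    by (rule sum.swap)
  also have "\<dots> = (\<Sum>j<n. c j * (\<Sum>i<n. K j i * vec_index z i))"
    by (intro sum.cong) (auto simp: sum_distrib_left sym intro!: sum.cong)
  also have "\<dots> = (\<Sum>j<n. c j * y j)"
    by (simp add: y)
  finally show ?thesis by (simp add: z_def)
qed

section \<open>Definite kernels and Kriging weights on finite sets\<close>

text \<open>For a covariance kernel and finite \<open>S\<close> the double sum is a variance, so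
  this is strict positive definiteness on \<open>S\<close>.\<close>

definition definite_on :: "('t \<Rightarrow> 't \<Rightarrow> real) \<Rightarrow> 't set \<Rightarrow> bool" where
  "definite_on k S \<longleftrightarrow>
     (\<forall>c. (\<Sum>a\<in>S. \<Sum>b\<in>S. c a * c b * k a b) = 0 \<longrightarrow> (\<forall>a\<in>S. c a = 0))"

text \<open>These are the normal equations. Weights are indexed by points instead of list positions,
  so that those of the whole data set and those of a group can be compared directly.\<close>

definition kriging_weights ::
  "('t \<Rightarrow> 't \<Rightarrow> real) \<Rightarrow> 't set \<Rightarrow> 't \<Rightarrow> ('t \<Rightarrow> real) \<Rightarrow> bool" where
  "kriging_weights k S t c \<longleftrightarrow> (\<forall>b\<in>S. (\<Sum>a\<in>S. k b a * c a) = k t b)"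

lemma definite_onD:
  assumes "definite_on k S" "(\<Sum>a\<in>S. \<Sum>b\<in>S. c a * c b * k a b) = 0" "a \<in> S"
  shows "c a = 0"
  using assms unfolding definite_on_def by blast

lemma definite_on_subset:
  assumes "definite_on k S" "finite S" "T \<subseteq> S"
  shows "definite_on k T"
  unfolding definite_on_def
proof (intro allI impI)
  fix c assume 0: "(\<Sum>a\<in>T. \<Sum>b\<in>T. c a * c b * k a b) = 0"
  define c' where "c' a = (if a \<in> T then c a else 0)" for a
  have "(\<Sum>a\<in>S. \<Sum>b\<in>S. c' a * c' b * k a b) = (\<Sum>a\<in>T. \<Sum>b\<in>S. c' a * c' b * k a b)"
    using assms by (intro sum.mono_neutral_right) (auto simp: c'_def)
  also have "\<dots> = (\<Sum>a\<in>T. \<Sum>b\<in>T. c' a * c' b * k a b)"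
    using assms by (intro sum.cong refl sum.mono_neutral_right) (auto simp: c'_def)
  also have "\<dots> = 0" using 0 by (simp add: c'_def)
  finally have "\<forall>a\<in>S. c' a = 0" using assms(1) unfolding definite_on_def by blast
  then show "\<forall>a\<in>T. c a = 0" using assms(3) by (auto simp: c'_def split: if_splits)
qed

lemma sum_set_distinct:
  assumes "distinct L"
  shows "(\<Sum>a\<in>set L. f a) = (\<Sum>i<length L. f (L ! i))"
  using sum.reindex_bij_betw[OF bij_betw_nth[OF assms refl refl], of f] by simp

lemma definite_on_imp_gram_inj:
  assumes "definite_on k (set L)" "distinct L"
    and 0: "\<forall>i<length L. (\<Sum>j<length L. k (L ! i) (L ! j) * c j) = 0"
  shows "\<forall>i<length L. c i = 0"
proof -
  \<comment> \<open>The coefficients are carried from positions to points; \<open>distinct L\<close>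
    makes the indexing invertible. A kernel vector of the Gram matrix is then a zero of the
    quadratic form.\<close>
  define c' where "c' = c \<circ> inv_into {..<length L} ((!) L)"
  have inj: "inj_on ((!) L) {..<length L}"
    using assms(2) by (auto simp: inj_on_def nth_eq_iff_index_eq)
  have c': "c' (L ! i) = c i" if "i < length L" for i
    using that inj by (simp add: c'_def inv_into_f_f)
  have "(\<Sum>a\<in>set L. \<Sum>b\<in>set L. c' a * c' b * k a b)
      = (\<Sum>i<length L. c i * (\<Sum>j<length L. k (L ! i) (L ! j) * c j))"
    by (auto simp: sum_set_distinct[OF assms(2)] c' sum_distrib_left mult_ac intro!: sum.cong)
  also have "\<dots> = 0" using 0 by simp
  finally have "\<forall>a\<in>set L. c' a = 0" using assms(1) unfolding definite_on_def by blast
  then show ?thesis using c' by force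
qed

lemma kriging_weights_exist:
  assumes "definite_on k (set L)" "distinct L"
  shows "\<exists>c. kriging_weights k (set L) t c"
proof -
  obtain c where c: "\<forall>i<length L. (\<Sum>j<length L. k (L ! i) (L ! j) * c j) = k t (L ! i)"
    using nonsingular_solvable[of "length L" "\<lambda>i j. k (L ! i) (L ! j)" "\<lambda>i. k t (L ! i)"]
      definite_on_imp_gram_inj[OF assms] by blast
  define c' where "c' = c \<circ> inv_into {..<length L} ((!) L)"
  have inj: "inj_on ((!) L) {..<length L}"
    using assms(2) by (auto simp: inj_on_def nth_eq_iff_index_eq)
  have c': "c' (L ! i) = c i" if "i < length L" for i
    using that inj by (simp add: c'_def inv_into_f_f)
  have "kriging_weights k (set L) t c'"
    unfolding kriging_weights_def using c
    by (auto simp: in_set_conv_nth sum_set_distinct[OF assms(2)] c')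
  then show ?thesis by blast
qed

lemma kriging_eq_weighted_sum:
  assumes "definite_on k (set L)" "distinct L" and sym: "\<And>s t. k s t = k t s"
    and w: "kriging_weights k (set L) t c"
  shows "kriging k Y L t \<omega> = (\<Sum>a\<in>set L. c a * Y a \<omega>)"
proof -
  have "Matrix.scalar_prod (Matrix.vec (length L) (\<lambda>i. k t (L ! i)))
      (inv_mat (Matrix.mat (length L) (length L) (\<lambda>(i, j). k (L ! i) (L ! j)))
        *\<^sub>v Matrix.vec (length L) (\<lambda>i. Y (L ! i) \<omega>)) = (\<Sum>i<length L. c (L ! i) * Y (L ! i) \<omega>)"
  proof (rule scalar_prod_inv_mat)
    show "\<forall>i<length L. c i = 0"
      if "\<forall>i<length L. (\<Sum>j<length L. k (L ! i) (L ! j) * c j) = 0" for c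
      using definite_on_imp_gram_inj[OF assms(1,2) that] .
    show "(\<Sum>j<length L. k (L ! i) (L ! j) * c (L ! j)) = k t (L ! i)" if "i < length L" for i
      using w that unfolding kriging_weights_def by (simp add: sum_set_distinct[OF assms(2)])
  qed (rule sym)
  moreover have "cov_vec k t L = Matrix.vec (length L) (\<lambda>i. k t (L ! i))"
    by (rule eq_vecI) (auto simp: cov_vec_def cov_mat_def Matrix.row_def)
  ultimately show ?thesis
    by (simp add: kriging_def cov_mat_def obs_vec_def sum_set_distinct[OF assms(2)])
qed

section \<open>Second moments and the nested predictor\<close>

text \<open>Linear predictors are compared in mean square, which involves \<open>Y\<close> only
  through its first and second moments.\<close>

locale centered_process = prob_space M
  for M :: "'a measure" +
  fixes Y :: "'t \<Rightarrow> 'a \<Rightarrow> real" and k :: "'t \<Rightarrow> 't \<Rightarrow> real"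
  assumes integrable_Y: "integrable M (Y t)"
    and mean_Y: "(LINT \<omega>|M. Y t \<omega>) = 0"
    and integrable_Y_Y: "integrable M (\<lambda>\<omega>. Y s \<omega> * Y t \<omega>)"
    and cov_Y: "(LINT \<omega>|M. Y s \<omega> * Y t \<omega>) = k s t"
begin

lemma cov_commute: "k s t = k t s"
  by (simp add: cov_Y[symmetric] mult.commute)

lemma integral_weighted_sums:
  "(LINT \<omega>|M. (\<Sum>a\<in>S. c a * Y a \<omega>) * (\<Sum>b\<in>T. d b * Y b \<omega>))
    = (\<Sum>a\<in>S. \<Sum>b\<in>T. c a * d b * k a b)"
proof -
  have "(\<lambda>\<omega>. (\<Sum>a\<in>S. c a * Y a \<omega>) * (\<Sum>b\<in>T. d b * Y b \<omega>))
      = (\<lambda>\<omega>. \<Sum>a\<in>S. \<Sum>b\<in>T. c a * d b * (Y a \<omega> * Y b \<omega>))"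
    by (simp add: sum_product mult_ac)
  then show ?thesis
    by (simp add: Bochner_Integration.integral_sum integrable_Y_Y cov_Y)
qed

lemma covariance_weighted_sums:
  "covariance M (\<lambda>\<omega>. \<Sum>a\<in>S. c a * Y a \<omega>) (\<lambda>\<omega>. \<Sum>b\<in>T. d b * Y b \<omega>)
    = (\<Sum>a\<in>S. \<Sum>b\<in>T. c a * d b * k a b)"
  unfolding covariance_def
  by (simp add: Bochner_Integration.integral_sum integrable_Y mean_Y integral_weighted_sums)

text \<open>The nested predictor is the orthogonal projection of \<open>Y t\<close> onto the span of
  the group predictors, the full one its projection onto the span of all observations. They agree
  iff the full predictor lies in the smaller span; definiteness turns this into a comparison of
  coefficients, group by group.\<close>

lemma nested_kriging_eq_full_iff:
  assumes S: "finite S" "definite_on k S"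
    and X: "disjoint_family_on X {..<p}" "(\<Union>i<p. X i) = S"
    and A: "\<And>i. i < p \<Longrightarrow> distinct (A i)" "\<And>i. i < p \<Longrightarrow> set (A i) = X i"
    and L: "distinct L" "set L = S"
    and nz: "\<And>i. i < p \<Longrightarrow> \<exists>b\<in>X i. k t b \<noteq> 0"
    and c: "kriging_weights k S t c"
    and d: "\<And>i. i < p \<Longrightarrow> kriging_weights k (X i) t (d i)"
  shows "(LINT \<omega>|M. (kriging k Y L t \<omega> - nested_kriging M k Y p A t \<omega>)\<^sup>2) = 0
    \<longleftrightarrow> (\<exists>\<beta>. \<forall>i<p. \<forall>a\<in>X i. c a = \<beta> i * d i a)"
proof -
  \<comment> \<open>Extension by zero puts all group predictors on the common index set
    \<open>S\<close>.\<close>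
  define e where "e i a = (if a \<in> X i then d i a else 0)" for i a
  have sub: "X i \<subseteq> S" if "i < p" for i using X(2) that by auto
  have full: "kriging k Y L t = (\<lambda>\<omega>. \<Sum>a\<in>S. c a * Y a \<omega>)"
    using kriging_eq_weighted_sum[of k L t c Y] S L c cov_commute by auto
  have grp: "kriging k Y (A i) t = (\<lambda>\<omega>. \<Sum>a\<in>S. e i a * Y a \<omega>)" if i: "i < p" for i
  proof
    fix \<omega>
    have "kriging k Y (A i) t \<omega> = (\<Sum>a\<in>X i. d i a * Y a \<omega>)"
      using kriging_eq_weighted_sum[of k "A i" t "d i" Y] d[OF i] A[OF i] cov_commute
        definite_on_subset[OF S(2,1) sub[OF i]] by auto
    also have "\<dots> = (\<Sum>a\<in>S. e i a * Y a \<omega>)"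
      using S(1) sub[OF i] by (intro sum.mono_neutral_cong_left) (auto simp: e_def)
    finally show "kriging k Y (A i) t \<omega> = (\<Sum>a\<in>S. e i a * Y a \<omega>)" .
  qed
  have sum_e: "(\<Sum>j<p. \<beta> j * e j a) = \<beta> i * d i a" if "i < p" "a \<in> X i" for i a \<beta>
  proof -
    have "(\<Sum>j<p. \<beta> j * e j a) = (\<Sum>j<p. if j = i then \<beta> i * d i a else 0)"
      using X(1) that by (intro sum.cong) (auto simp: e_def disjoint_family_on_def)
    then show ?thesis using that by simp
  qed
  \<comment> \<open>A group predictor with all weights zero would make the covariance matrix of the
    predictors singular; \<open>nz\<close> excludes this.\<close>
  have d_nz: "\<exists>a\<in>X i. d i a \<noteq> 0" if i: "i < p" for i
  proof (rule ccontr)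
    assume "\<not> ?thesis"
    then have "k t b = 0" if "b \<in> X i" for b
      using d[OF i] that unfolding kriging_weights_def by force
    then show False using nz[OF i] by blast
  qed
  \<comment> \<open>The covariance matrix of the group predictors and, in \<open>kM\<close>, their
    covariances with \<open>Y t\<close>, both written through the weights.\<close>
  define K where "K i j = (\<Sum>a\<in>S. \<Sum>b\<in>S. e i a * e j b * k a b)" for i j
  define kM where "kM i = (\<Sum>a\<in>S. e i a * k t a)" for i
  have K_sum: "(\<Sum>j<p. K i j * \<beta> j) = (\<Sum>a\<in>S. \<Sum>b\<in>S. e i a * (\<Sum>j<p. \<beta> j * e j b) * k a b)"
    for i \<beta>
  proof -
    have "(\<Sum>j<p. K i j * \<beta> j) = (\<Sum>j<p. \<Sum>a\<in>S. \<Sum>b\<in>S. e i a * (\<beta> j * e j b) * k a b)"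
      by (simp add: K_def sum_distrib_left sum_distrib_right mult_ac)
    also have "\<dots> = (\<Sum>a\<in>S. \<Sum>j<p. \<Sum>b\<in>S. e i a * (\<beta> j * e j b) * k a b)"
      by (rule sum.swap)
    also have "\<dots> = (\<Sum>a\<in>S. \<Sum>b\<in>S. \<Sum>j<p. e i a * (\<beta> j * e j b) * k a b)"
      by (intro sum.cong refl sum.swap)
    finally show ?thesis by (simp add: sum_distrib_left sum_distrib_right)
  qed
  \<comment> \<open>The quadratic form of \<open>K\<close> at \<open>\<beta>\<close> is that of
    \<open>k\<close> at the combined weights \<open>?g\<close>, so \<open>?g\<close> vanishes on
    \<open>S\<close>. On \<open>X i\<close> it equals \<open>\<beta> i * d i a\<close>, and some
    \<open>d i a\<close> is nonzero.\<close>
  have inj: "\<forall>i<p. \<beta> i = 0" if 0: "\<forall>i<p. (\<Sum>j<p. K i j * \<beta> j) = 0" for \<beta>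
  proof -
    let ?g = "\<lambda>b. \<Sum>j<p. \<beta> j * e j b"
    have "(\<Sum>a\<in>S. \<Sum>b\<in>S. ?g a * ?g b * k a b)
        = (\<Sum>a\<in>S. \<Sum>b\<in>S. \<Sum>i<p. \<beta> i * (e i a * ?g b * k a b))"
      by (simp only: sum_distrib_right mult.assoc)
    also have "\<dots> = (\<Sum>a\<in>S. \<Sum>i<p. \<Sum>b\<in>S. \<beta> i * (e i a * ?g b * k a b))"
      by (intro sum.cong refl sum.swap)
    also have "\<dots> = (\<Sum>i<p. \<Sum>a\<in>S. \<Sum>b\<in>S. \<beta> i * (e i a * ?g b * k a b))"
      by (rule sum.swap)
    also have "\<dots> = (\<Sum>i<p. \<beta> i * (\<Sum>j<p. K i j * \<beta> j))"
      by (simp add: K_sum sum_distrib_left)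
    also have "\<dots> = 0" using 0 by simp
    finally have g: "?g a = 0" if "a \<in> S" for a
      using definite_onD[OF S(2), of ?g a] that by blast
    show ?thesis
    proof (intro allI impI)
      fix i assume i: "i < p"
      obtain a where a: "a \<in> X i" "d i a \<noteq> 0" using d_nz[OF i] by blast
      then show "\<beta> i = 0" using g sum_e[OF i a(1), of \<beta>] sub[OF i] by auto
    qed
  qed
  have "nested_kriging M k Y p A t = (\<lambda>\<omega>. Matrix.scalar_prod (Matrix.vec p kM)
      (inv_mat (Matrix.mat p p (\<lambda>(i, j). K i j))
        *\<^sub>v Matrix.vec p (\<lambda>i. \<Sum>a\<in>S. e i a * Y a \<omega>)))"
  proof
    fix \<omega>
    have cov_m: "covariance M (kriging k Y (A i) t) (Y t) = kM i" if "i < p" for i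
    proof -
      \<comment> \<open>\<open>Y t\<close> is written as a one-term weighted sum to fit
        \<open>covariance_weighted_sums\<close>.\<close>
      have "covariance M (\<lambda>\<omega>. \<Sum>a\<in>S. e i a * Y a \<omega>) (\<lambda>\<omega>. \<Sum>b\<in>{t}. 1 * Y b \<omega>) = kM i"
        unfolding covariance_weighted_sums by (simp add: kM_def cov_commute[of t])
      then show ?thesis by (simp add: grp[OF that])
    qed
    have 1: "Matrix.vec p (\<lambda>i. covariance M (kriging k Y (A i) t) (Y t)) = Matrix.vec p kM"
      by (rule eq_vecI) (auto simp: cov_m)
    have 2: "Matrix.mat p p (\<lambda>(i, j). covariance M (kriging k Y (A i) t) (kriging k Y (A j) t))
        = Matrix.mat p p (\<lambda>(i, j). K i j)"
      by (rule eq_matI) (auto simp: grp covariance_weighted_sums K_def)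
    have 3: "Matrix.vec p (\<lambda>i. kriging k Y (A i) t \<omega>)
        = Matrix.vec p (\<lambda>i. \<Sum>a\<in>S. e i a * Y a \<omega>)"
      by (rule eq_vecI) (auto simp: grp)
    show "nested_kriging M k Y p A t \<omega> = Matrix.scalar_prod (Matrix.vec p kM)
      (inv_mat (Matrix.mat p p (\<lambda>(i, j). K i j))
        *\<^sub>v Matrix.vec p (\<lambda>i. \<Sum>a\<in>S. e i a * Y a \<omega>))"
      unfolding nested_kriging_def aggregate_def 1 2 3 ..
  qed
  \<comment> \<open>The solution \<open>\<beta>\<close> stays arbitrary: below, one direction takes
    it from solvability, the other inserts the given proportionality factors.\<close>
  also have "\<dots> = (\<lambda>\<omega>. \<Sum>i<p. \<beta> i * (\<Sum>a\<in>S. e i a * Y a \<omega>))"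
    if "\<And>i. i < p \<Longrightarrow> (\<Sum>j<p. K i j * \<beta> j) = kM i" for \<beta>
  proof (rule ext, rule scalar_prod_inv_mat)
    show "K i j = K j i" for i j
      unfolding K_def by (subst sum.swap) (simp add: cov_commute mult_ac)
  qed (use that inj in blast)+
  also have "(\<lambda>\<omega>. \<Sum>i<p. \<beta> i * (\<Sum>a\<in>S. e i a * Y a \<omega>))
      = (\<lambda>\<omega>. \<Sum>a\<in>S. (\<Sum>i<p. \<beta> i * e i a) * Y a \<omega>)" for \<beta>
    by (simp add: sum_distrib_left sum_distrib_right mult_ac) (subst sum.swap, rule refl)
  finally have nested:
    "nested_kriging M k Y p A t = (\<lambda>\<omega>. \<Sum>a\<in>S. (\<Sum>i<p. \<beta> i * e i a) * Y a \<omega>)"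
    if "\<And>i. i < p \<Longrightarrow> (\<Sum>j<p. K i j * \<beta> j) = kM i" for \<beta>
    using that by blast
  have diff: "(LINT \<omega>|M. (kriging k Y L t \<omega> - nested_kriging M k Y p A t \<omega>)\<^sup>2)
      = (\<Sum>a\<in>S. \<Sum>b\<in>S. (c a - (\<Sum>i<p. \<beta> i * e i a)) * (c b - (\<Sum>i<p. \<beta> i * e i b)) * k a b)"
    if "\<And>i. i < p \<Longrightarrow> (\<Sum>j<p. K i j * \<beta> j) = kM i" for \<beta>
    unfolding integral_weighted_sums[symmetric]
    by (simp add: full nested[OF that] power2_eq_square left_diff_distrib sum_subtractf)
  show ?thesis
  proof
    assume 0: "(LINT \<omega>|M. (kriging k Y L t \<omega> - nested_kriging M k Y p A t \<omega>)\<^sup>2) = 0"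
    obtain \<beta> where \<beta>: "\<And>i. i < p \<Longrightarrow> (\<Sum>j<p. K i j * \<beta> j) = kM i"
      using nonsingular_solvable[of p K kM] inj by blast
    have "c a - (\<Sum>i<p. \<beta> i * e i a) = 0" if "a \<in> S" for a
      using definite_onD[OF S(2) trans[OF diff[OF \<beta>, symmetric] 0] that] .
    then have "\<forall>i<p. \<forall>a\<in>X i. c a = \<beta> i * d i a"
      using sum_e[of _ _ \<beta>] sub by force
    then show "\<exists>\<beta>. \<forall>i<p. \<forall>a\<in>X i. c a = \<beta> i * d i a" by blast
  next
    assume "\<exists>\<beta>. \<forall>i<p. \<forall>a\<in>X i. c a = \<beta> i * d i a"
    then obtain \<beta> where \<beta>: "\<forall>i<p. \<forall>a\<in>X i. c a = \<beta> i * d i a" by blast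
    have g: "(\<Sum>i<p. \<beta> i * e i a) = c a" if "a \<in> S" for a
    proof -
      obtain i where "i < p" "a \<in> X i" using X(2) \<open>a \<in> S\<close> by blast
      then show ?thesis using \<beta> sum_e by simp
    qed
    \<comment> \<open>The given factors solve the aggregation system: their combined weights are
      \<open>c\<close>, and the normal equations of \<open>c\<close>, weighted by \<open>e i\<close>
      and summed over \<open>S\<close>, give its row \<open>i\<close>.\<close>
    have "(\<Sum>j<p. K i j * \<beta> j) = kM i" for i
    proof -
      have "(\<Sum>j<p. K i j * \<beta> j) = (\<Sum>a\<in>S. \<Sum>b\<in>S. e i a * c b * k a b)"
        unfolding K_sum by (intro sum.cong refl) (simp only: g)
      also have "\<dots> = (\<Sum>a\<in>S. e i a * (\<Sum>b\<in>S. k a b * c b))"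
        by (simp add: sum_distrib_left mult_ac)
      also have "\<dots> = kM i"
        using c unfolding kM_def kriging_weights_def by simp
      finally show ?thesis .
    qed
    from diff[OF this]
    show "(LINT \<omega>|M. (kriging k Y L t \<omega> - nested_kriging M k Y p A t \<omega>)\<^sup>2) = 0"
      by (simp add: g)
  qed
qed

end

lemma centered_gaussian_process_imp_centered_process:
  assumes "centered_gaussian_process M UNIV k Y" and k: "\<And>t. k t t \<noteq> 0"
  shows "centered_process M Y k"
proof -
  have gp: "gaussian_process M UNIV Y" and mean: "\<And>t. (LINT \<omega>|M. Y t \<omega>) = 0"
    and cov: "\<And>s t. covariance M (Y s) (Y t) = k s t"
    using assms(1) unfolding centered_gaussian_process_def by auto
  interpret prob_space M using gp unfolding gaussian_process_def by blast
  have meas[measurable]: "Y t \<in> borel_measurable M" for t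
    using gp unfolding gaussian_process_def by blast
  have kst: "(LINT \<omega>|M. Y s \<omega> * Y t \<omega>) = k s t" for s t
    using cov[of s t] unfolding covariance_def by (simp add: mean)
  \<comment> \<open>A non-integrable square would have integral \<open>0\<close>, contradicting \<open>k t t \<noteq> 0\<close>.\<close>
  have sq: "integrable M (\<lambda>\<omega>. (Y t \<omega>)\<^sup>2)" for t
    unfolding power2_eq_square using kst[of t t] k[of t] not_integrable_integral_eq by metis
  have prod: "integrable M (\<lambda>\<omega>. Y s \<omega> * Y t \<omega>)" for s t
  proof (rule Bochner_Integration.integrable_bound)
    show "integrable M (\<lambda>\<omega>. (Y s \<omega>)\<^sup>2 + (Y t \<omega>)\<^sup>2)" using sq by simp
    have "\<bar>a * b\<bar> \<le> a\<^sup>2 + b\<^sup>2" for a b :: real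
      using sum_squares_bound[of "\<bar>a\<bar>" "\<bar>b\<bar>"] abs_ge_zero[of "a * b"]
      unfolding abs_mult power2_abs by linarith
    then show "AE \<omega> in M. norm (Y s \<omega> * Y t \<omega>) \<le> norm ((Y s \<omega>)\<^sup>2 + (Y t \<omega>)\<^sup>2)"
      by (auto simp: abs_of_nonneg)
  qed simp
  show ?thesis
    by unfold_locales
      (auto simp: mean kst prod intro: square_integrable_imp_integrable[OF meas sq])
qed

section \<open>The exponential covariance: definiteness and explicit weights\<close>

text \<open>Points are added in increasing order. By the Markov property a new maximum
  \<open>m\<close> is linked to the older points only through its left neighbour \<open>u\<close>.
  Completing the square splits the form into the old one, with its coefficient at \<open>u\<close>
  shifted, plus a positive multiple of the square of \<open>c m\<close>.\<close>

lemma definite_on_exp_cov: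
  assumes "0 < \<sigma>2" "0 < \<theta>" "finite S"
  shows "definite_on (exp_cov \<sigma>2 \<theta>) S"
proof -
  let ?k = "exp_cov \<sigma>2 \<theta>"
  let ?Q = "\<lambda>S c. \<Sum>a\<in>S. \<Sum>b\<in>S. c a * c b * ?k a b"
  have sym: "?k s t = ?k t s" for s t by (simp add: exp_cov_def abs_minus_commute)
  have diag: "?k s s = \<sigma>2" for s by (simp add: exp_cov_def)
  \<comment> \<open>Nonnegativity is carried through the induction so that a vanishing sum of two
    terms makes each of them vanish.\<close>
  have "\<forall>c. 0 \<le> ?Q S c \<and> (?Q S c = 0 \<longrightarrow> (\<forall>a\<in>S. c a = 0))"
    using \<open>finite S\<close>
  proof (induction S rule: finite_linorder_max_induct)
    case empty
    then show ?case by simp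
  next
    case (insert m S)
    have m: "m \<notin> S" using insert.hyps(2) by blast
    have expand: "?Q (insert m S) c = ?Q S c + 2 * c m * (\<Sum>a\<in>S. c a * ?k a m) + (c m)\<^sup>2 * \<sigma>2" for c
    proof -
      have "(\<Sum>b\<in>S. c m * c b * ?k m b) = c m * (\<Sum>a\<in>S. c a * ?k a m)"
        "(\<Sum>a\<in>S. c a * c m * ?k a m) = c m * (\<Sum>a\<in>S. c a * ?k a m)"
        by (simp_all add: sum_distrib_left sym[of m] mult_ac)
      then show ?thesis
        using insert.hyps(1) m by (simp add: sum.distrib diag power2_eq_square algebra_simps)
    qed
    show ?case
    proof (cases "S = {}")
      case True
      then show ?thesis using \<open>0 < \<sigma>2\<close> by (simp add: diag)
    next
      case False
      define u where "u = Max S"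
      have u: "u \<in> S" "\<And>a. a \<in> S \<Longrightarrow> a \<le> u" "u < m"
        using False insert.hyps by (auto simp: u_def)
      define \<rho> where "\<rho> = exp (- (m - u) / \<theta>)"
      have \<rho>: "0 < \<rho>" "\<rho> < 1" using u(3) \<open>0 < \<theta>\<close> by (auto simp: \<rho>_def divide_neg_pos)
      then have \<rho>2: "0 < 1 - \<rho>\<^sup>2" by (simp add: power_less_one_iff abs_square_less_1)
      \<comment> \<open>The Markov property: since \<open>a \<le> u\<close> and
        \<open>u < m\<close>, distances add up at \<open>u\<close> and exponentials
        multiply.\<close>
      have km: "?k a m = \<rho> * ?k a u" if "a \<in> S" for a
      proof -
        have "a \<le> u" using u(2) that .
        then have "- \<bar>a - m\<bar> / \<theta> = - (m - u) / \<theta> + - \<bar>a - u\<bar> / \<theta>"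
          using u(3) by (simp add: diff_divide_distrib add_divide_distrib[symmetric])
        then show ?thesis by (simp add: exp_cov_def \<rho>_def exp_add[symmetric])
      qed
      \<comment> \<open>Regressing the last variable on its left neighbour leaves an orthogonal residual.\<close>
      have Q: "?Q (insert m S) c
          = ?Q S (\<lambda>a. c a + (if a = u then c m * \<rho> else 0)) + (c m)\<^sup>2 * (\<sigma>2 * (1 - \<rho>\<^sup>2))" for c
      proof -
        define \<delta> where "\<delta> = c m * \<rho>"
        have "?Q S (\<lambda>a. c a + (if a = u then \<delta> else 0))
            = ?Q S c + (\<Sum>a\<in>S. \<Sum>b\<in>S. if b = u then c a * \<delta> * ?k a u else 0)
              + (\<Sum>a\<in>S. if a = u then \<Sum>b\<in>S. \<delta> * c b * ?k u b else 0)
              + (\<Sum>a\<in>S. if a = u then \<Sum>b\<in>S. if b = u then \<delta> * \<delta> * ?k u u else 0 else 0)"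
          unfolding sum.distrib[symmetric]
          by (intro sum.cong refl) (auto simp: sum.distrib[symmetric] algebra_simps intro!: sum.cong)
        also have "\<dots> = ?Q S c + (\<Sum>a\<in>S. c a * \<delta> * ?k a u) + (\<Sum>b\<in>S. \<delta> * c b * ?k u b) + \<delta>\<^sup>2 * \<sigma>2"
          using insert.hyps(1) u(1) by (simp add: diag power2_eq_square)
        also have "\<dots> = ?Q S c + 2 * (c m * (\<Sum>a\<in>S. c a * ?k a m)) + \<delta>\<^sup>2 * \<sigma>2"
        proof -
          have "(\<Sum>a\<in>S. c a * \<delta> * ?k a u) = c m * (\<Sum>a\<in>S. c a * ?k a m)"
            "(\<Sum>b\<in>S. \<delta> * c b * ?k u b) = c m * (\<Sum>a\<in>S. c a * ?k a m)"
            unfolding sum_distrib_left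
            by (intro sum.cong; simp add: km \<delta>_def sym[of u])+
          then show ?thesis by simp
        qed
        finally have Q\<delta>: "?Q S (\<lambda>a. c a + (if a = u then \<delta> else 0))
            = ?Q S c + 2 * (c m * (\<Sum>a\<in>S. c a * ?k a m)) + \<delta>\<^sup>2 * \<sigma>2" .
        have "\<delta>\<^sup>2 = (c m)\<^sup>2 * \<rho>\<^sup>2" by (simp add: \<delta>_def power_mult_distrib)
        then show ?thesis
          unfolding expand \<delta>_def[symmetric] Q\<delta> by (simp add: right_diff_distrib)
      qed
      show ?thesis
      proof (intro allI conjI impI)
        fix c
        let ?c = "\<lambda>a. c a + (if a = u then c m * \<rho> else 0)"
        have r: "0 < \<sigma>2 * (1 - \<rho>\<^sup>2)" using \<rho>2 \<open>0 < \<sigma>2\<close> by simp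
        have nonneg: "0 \<le> ?Q S ?c" "0 \<le> (c m)\<^sup>2 * (\<sigma>2 * (1 - \<rho>\<^sup>2))"
          using insert.IH[THEN spec, of ?c] r by (blast, simp)
        then show "0 \<le> ?Q (insert m S) c" unfolding Q by (rule add_nonneg_nonneg)
        assume "?Q (insert m S) c = 0"
        then have Q0: "?Q S ?c = 0" and "(c m)\<^sup>2 * (\<sigma>2 * (1 - \<rho>\<^sup>2)) = 0"
          using nonneg unfolding Q by (simp_all only: add_nonneg_eq_0_iff)
        then have "c m = 0" using \<rho>2 \<open>0 < \<sigma>2\<close> by auto
        moreover have "\<forall>a\<in>S. ?c a = 0"
          using conjunct2[OF insert.IH[THEN spec, of ?c]] Q0 by (rule mp)
        ultimately show "\<forall>a\<in>insert m S. c a = 0" by (simp cong: if_cong)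
      qed
    qed
  qed
  then show ?thesis unfolding definite_on_def by blast
qed

text \<open>
  The Kriging weights when \<open>a\<close> separates \<open>t\<close> from the data, respectively when the neighbours
  of \<open>t\<close> in the data are \<open>u\<close> and \<open>v\<close>.
\<close>

definition point_weight :: "real \<Rightarrow> real \<Rightarrow> real \<Rightarrow> real \<Rightarrow> real" where
  "point_weight \<theta> t a b = (if b = a then exp (- \<bar>t - a\<bar> / \<theta>) else 0)"

definition bridge_weight :: "real \<Rightarrow> real \<Rightarrow> real \<Rightarrow> real \<Rightarrow> real \<Rightarrow> real" where
  "bridge_weight \<theta> t u v b =
     (if b = u then sinh ((v - t) / \<theta>) / sinh ((v - u) / \<theta>)
      else if b = v then sinh ((t - u) / \<theta>) / sinh ((v - u) / \<theta>) else 0)"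

text \<open>By \<open>sep\<close>, \<open>a\<close> lies between \<open>t\<close> and every data
  point. Distances from \<open>t\<close> therefore split at \<open>a\<close>, and the covariance
  with \<open>t\<close> is a fixed multiple of the covariance with \<open>a\<close>.\<close>

lemma kriging_weights_point:
  assumes "finite S" "a \<in> S" and sep: "\<And>b. b \<in> S \<Longrightarrow> \<bar>t - b\<bar> = \<bar>t - a\<bar> + \<bar>a - b\<bar>"
  shows "kriging_weights (exp_cov \<sigma>2 \<theta>) S t (point_weight \<theta> t a)"
  unfolding kriging_weights_def
proof
  fix b assume b: "b \<in> S"
  have "(\<Sum>a'\<in>S. exp_cov \<sigma>2 \<theta> b a' * point_weight \<theta> t a a')
      = (\<Sum>a'\<in>S. if a' = a then exp_cov \<sigma>2 \<theta> b a * exp (- \<bar>t - a\<bar> / \<theta>) else 0)"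
    by (intro sum.cong) (auto simp: point_weight_def)
  also have "\<dots> = exp_cov \<sigma>2 \<theta> b a * exp (- \<bar>t - a\<bar> / \<theta>)"
    using assms(1,2) by simp
  also have "\<dots> = \<sigma>2 * exp (- \<bar>b - a\<bar> / \<theta> + - \<bar>t - a\<bar> / \<theta>)"
    by (simp only: exp_cov_def exp_add mult.assoc)
  also have "- \<bar>b - a\<bar> / \<theta> + - \<bar>t - a\<bar> / \<theta> = - \<bar>t - b\<bar> / \<theta>"
    unfolding sep[OF b] by (simp add: abs_minus_commute add_divide_distrib diff_divide_distrib)
  finally show "(\<Sum>a'\<in>S. exp_cov \<sigma>2 \<theta> b a' * point_weight \<theta> t a a') = exp_cov \<sigma>2 \<theta> t b"
    by (simp add: exp_cov_def)
qed

text \<open>Interpolation between \<open>u\<close> and \<open>v\<close> with sinh weights is exact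
  for solutions of f'' = f, here the decreasing and the increasing exponential.\<close>

lemma sinh_bridge:
  fixes t u v :: real
  shows "sinh (v - t) * exp (- u) + sinh (t - u) * exp (- v) = sinh (v - u) * exp (- t)"
    and "sinh (v - t) * exp u + sinh (t - u) * exp v = sinh (v - u) * exp t"
proof -
  have s: "sinh (a - b) = (exp a * exp (- b) - exp b * exp (- a)) / 2" for a b :: real
    by (simp add: sinh_field_def exp_add[symmetric])
  \<comment> \<open>Primed letters stand for exponentials of negated arguments; the identities are
    polynomial and hold for independent values.\<close>
  have ring: "(V * T' - T * V') / 2 * U' + (T * U' - U * T') / 2 * V' = (V * U' - U * V') / 2 * T'"
    "(V * T' - T * V') / 2 * U + (T * U' - U * T') / 2 * V = (V * U' - U * V') / 2 * T"
    for T T' U U' V V' :: real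
    by (simp_all add: field_simps)
  show "sinh (v - t) * exp (- u) + sinh (t - u) * exp (- v) = sinh (v - u) * exp (- t)"
    and "sinh (v - t) * exp u + sinh (t - u) * exp v = sinh (v - u) * exp t"
    unfolding s by (simp_all only: ring)
qed

text \<open>Between \<open>u\<close> and \<open>v\<close>, the covariance with a data point on the
  left is a multiple of a decreasing exponential, with one on the right of an increasing
  exponential. By \<open>sinh_bridge\<close> the same two weights reproduce both.\<close>

lemma kriging_weights_bridge:
  assumes \<theta>: "0 < \<theta>" "finite S" "u \<in> S" "v \<in> S" "u < t" "t < v"
    and adj: "\<And>b. b \<in> S \<Longrightarrow> b \<le> u \<or> v \<le> b"
  shows "kriging_weights (exp_cov \<sigma>2 \<theta>) S t (bridge_weight \<theta> t u v)"
  unfolding kriging_weights_def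
proof
  fix b assume b: "b \<in> S"
  let ?s = "\<lambda>x y. sinh ((y - x) / \<theta>)"
  have uv: "u < v" using assms by simp
  have "(\<Sum>a\<in>S. exp_cov \<sigma>2 \<theta> b a * bridge_weight \<theta> t u v a)
      = (\<Sum>a\<in>S. (if a = u then exp_cov \<sigma>2 \<theta> b u * (?s t v / ?s u v) else 0)
          + (if a = v then exp_cov \<sigma>2 \<theta> b v * (?s u t / ?s u v) else 0))"
    using uv by (intro sum.cong) (auto simp: bridge_weight_def)
  also have "\<dots> = exp_cov \<sigma>2 \<theta> b u * (?s t v / ?s u v) + exp_cov \<sigma>2 \<theta> b v * (?s u t / ?s u v)"
    using assms by (simp add: sum.distrib)
  also have "\<dots> = \<sigma>2 * ((?s t v * exp (- \<bar>b - u\<bar> / \<theta>) + ?s u t * exp (- \<bar>b - v\<bar> / \<theta>)) / ?s u v)"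
    by (simp add: exp_cov_def add_divide_distrib algebra_simps)
  also have "?s t v * exp (- \<bar>b - u\<bar> / \<theta>) + ?s u t * exp (- \<bar>b - v\<bar> / \<theta>)
      = ?s u v * exp (- \<bar>t - b\<bar> / \<theta>)"
  proof -
    note br = sinh_bridge[of "v / \<theta>" "t / \<theta>" "u / \<theta>", folded diff_divide_distrib]
    consider "b \<le> u" | "v \<le> b" using adj[OF b] by blast
    then show ?thesis
    proof cases
      case 1
      then have e: "- \<bar>b - u\<bar> / \<theta> = b / \<theta> + - (u / \<theta>)" "- \<bar>b - v\<bar> / \<theta> = b / \<theta> + - (v / \<theta>)"
        "- \<bar>t - b\<bar> / \<theta> = b / \<theta> + - (t / \<theta>)"
        using assms by (simp_all add: diff_divide_distrib)
      show ?thesis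
        using arg_cong[OF br(1), of "\<lambda>z. exp (b / \<theta>) * z"] unfolding e exp_add
        by (simp only: distrib_left mult.left_commute)
    next
      case 2
      then have e: "- \<bar>b - u\<bar> / \<theta> = - (b / \<theta>) + u / \<theta>" "- \<bar>b - v\<bar> / \<theta> = - (b / \<theta>) + v / \<theta>"
        "- \<bar>t - b\<bar> / \<theta> = - (b / \<theta>) + t / \<theta>"
        using assms by (simp_all add: diff_divide_distrib)
      show ?thesis
        using arg_cong[OF br(2), of "\<lambda>z. exp (- (b / \<theta>)) * z"] unfolding e exp_add
        by (simp only: distrib_left mult.left_commute)
    qed
  qed
  finally show "(\<Sum>a\<in>S. exp_cov \<sigma>2 \<theta> b a * bridge_weight \<theta> t u v a) = exp_cov \<sigma>2 \<theta> t b"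
    using uv \<theta> by (simp add: exp_cov_def)
qed

text \<open>If \<open>t\<close> is in \<open>S\<close>, it separates itself; if \<open>S\<close>
  lies on one side of \<open>t\<close>, its nearest end separates. Otherwise the neighbours are the
  maximum below and the minimum above \<open>t\<close>.\<close>

lemma separating_point_or_neighbours:
  fixes S :: "real set" and t :: real
  assumes "finite S" "S \<noteq> {}"
  obtains (point) a where "a \<in> S" "\<And>b. b \<in> S \<Longrightarrow> \<bar>t - b\<bar> = \<bar>t - a\<bar> + \<bar>a - b\<bar>"
  | (bridge) u v where "u \<in> S" "v \<in> S" "u < t" "t < v" "\<And>b. b \<in> S \<Longrightarrow> b \<le> u \<or> v \<le> b"
proof -
  let ?L = "{a \<in> S. a < t}" and ?R = "{a \<in> S. t < a}"
  consider "t \<in> S" | "?L = {}" | "?R = {}" | "t \<notin> S" "?L \<noteq> {}" "?R \<noteq> {}" by blast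
  then show thesis
  proof cases
    case 1
    then show thesis by (intro point) auto
  next
    case 2
    have "Min S \<in> S" using assms by simp
    moreover have "t \<le> Min S" "Min S \<le> b" if "b \<in> S" for b
      using 2 that assms by force+
    ultimately show thesis by (intro point[of "Min S"]) force+
  next
    case 3
    have "Max S \<in> S" using assms by simp
    moreover have "Max S \<le> t" "b \<le> Max S" if "b \<in> S" for b
      using 3 that assms by force+
    ultimately show thesis by (intro point[of "Max S"]) force+
  next
    case 4
    have fin: "finite ?L" "finite ?R" using assms by auto
    have "Max ?L \<in> ?L" "Min ?R \<in> ?R" using 4 fin Max_in Min_in by blast+
    moreover have "b \<le> Max ?L \<or> Min ?R \<le> b" if "b \<in> S" for b
    proof (cases "b < t")
      case True
      then show ?thesis using Max_ge[OF fin(1), of b] that by simp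
    next
      case False
      then have "t < b" using that 4(1) by (cases "b = t") auto
      then show ?thesis using Min_le[OF fin(2), of b] that by simp
    qed
    ultimately show thesis by (intro bridge[of "Max ?L" "Min ?R"]) auto
  qed
qed

lemma bridge_weight_pos:
  assumes "0 < \<theta>" "u < t" "t < v"
  shows "0 < bridge_weight \<theta> t u v u" "0 < bridge_weight \<theta> t u v v"
proof -
  have "0 < sinh ((v - t) / \<theta>)" "0 < sinh ((t - u) / \<theta>)" "0 < sinh ((v - u) / \<theta>)" and "v \<noteq> u"
    using assms by simp_all
  then show "0 < bridge_weight \<theta> t u v u" "0 < bridge_weight \<theta> t u v v"
    unfolding bridge_weight_def by (simp_all only: if_True if_False divide_pos_pos simp_thms)
qed

section \<open>Proportional weights versus perfect clustering\<close>

theorem proposition6: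
  fixes M :: "'a measure"
    and Y :: "real \<Rightarrow> 'a \<Rightarrow> real"
    and \<sigma>2 \<theta> :: real
    and n p :: nat
    and x :: "nat \<Rightarrow> real"
    and X :: "nat \<Rightarrow> real set"
    and A :: "nat \<Rightarrow> real list"
  assumes "0 < \<sigma>2" and "0 < \<theta>"
    and "centered_gaussian_process M UNIV (exp_cov \<sigma>2 \<theta>) Y"
    and "1 \<le> n"
    and "inj_on x {..<n}"
    and "\<And>i. i < p \<Longrightarrow> X i \<noteq> {}"
    and "disjoint_family_on X {..<p}"
    and "(\<Union>i<p. X i) = x ` {..<n}"
    and "\<And>i. i < p \<Longrightarrow> distinct (A i)"
    and "\<And>i. i < p \<Longrightarrow> set (A i) = X i"
  shows "(\<forall>t. (LINT \<omega>|M. (kriging (exp_cov \<sigma>2 \<theta>) Y (map x [0..<n]) t \<omega>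
                - nested_kriging M (exp_cov \<sigma>2 \<theta>) Y p A t \<omega>)\<^sup>2) = 0)
         \<longleftrightarrow> perfect_clustering p X"
proof -
  let ?k = "exp_cov \<sigma>2 \<theta>"
  define S where "S = x ` {..<n}"
  note \<theta> = \<open>0 < \<theta>\<close> and ne = assms(6) and disj = assms(7) and A = assms(9,10)
  have X: "(\<Union>i<p. X i) = S" using assms(8) by (simp add: S_def)
  have S: "finite S" "S \<noteq> {}" using \<open>1 \<le> n\<close> by (auto simp: S_def lessThan_empty_iff)
  have sub: "X i \<subseteq> S" if "i < p" for i using X that by auto
  have fin: "finite (X i)" if "i < p" for i using finite_subset[OF sub[OF that] S(1)] .
  have same: "i = j" if "i < p" "j < p" "a \<in> X i" "a \<in> X j" for i j a
    using disj that unfolding disjoint_family_on_def by blast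
  have definite: "definite_on ?k T" if "finite T" for T
    using definite_on_exp_cov assms(1,2) that by blast
  have k_pos: "0 < ?k s t" for s t using \<open>0 < \<sigma>2\<close> by (simp add: exp_cov_def)
  interpret centered_process M Y ?k
    by (rule centered_gaussian_process_imp_centered_process[OF assms(3)]) (use k_pos in \<open>simp add: less_imp_neq[symmetric]\<close>)
  have L: "distinct (map x [0..<n])" "set (map x [0..<n]) = S"
    using assms(5) by (auto simp: S_def distinct_map lessThan_atLeast0)
  let ?zero = "\<lambda>t. (LINT \<omega>|M. (kriging ?k Y (map x [0..<n]) t \<omega>
                - nested_kriging M ?k Y p A t \<omega>)\<^sup>2) = 0"
  \<comment> \<open>Any solutions of the normal equations may be supplied, so closed forms can be
    inserted for \<open>c\<close> and for selected groups.\<close>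
  have zero_iff: "?zero t \<longleftrightarrow> (\<exists>\<beta>. \<forall>i<p. \<forall>a\<in>X i. c a = \<beta> i * d i a)"
    if "kriging_weights ?k S t c" "\<And>i. i < p \<Longrightarrow> kriging_weights ?k (X i) t (d i)" for t c d
  proof (rule nested_kriging_eq_full_iff[OF S(1) definite[OF S(1)] disj X A L _ that])
    show "\<exists>b\<in>X i. ?k t b \<noteq> 0" if "i < p" for i
      using ne[OF that] k_pos by (metis all_not_in_conv less_irrefl)
  qed
  \<comment> \<open>Some choice of weights for the groups that receive no closed form below.\<close>
  have "\<exists>d. \<forall>i<p. kriging_weights ?k (X i) t (d i)" for t
  proof -
    have "\<forall>i. \<exists>d. i < p \<longrightarrow> kriging_weights ?k (X i) t d"
      using kriging_weights_exist[of ?k "A _" t] A definite fin by metis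
    then show ?thesis by (rule choice[THEN exE]) blast
  qed
  then obtain d where d: "\<And>t i. i < p \<Longrightarrow> kriging_weights ?k (X i) t (d t i)"
    by metis
  show ?thesis
  proof
    assume zero: "\<forall>t. ?zero t"
    show "perfect_clustering p X"
      unfolding perfect_clustering_def
    proof (intro notI, elim bexE conjE)
      fix i j u0 v0 w
      assume "i \<in> {..<p}" "j \<in> {..<p}" and ij: "i \<noteq> j"
        and u0: "u0 \<in> X i" "u0 < w" and v0: "v0 \<in> X i" "w < v0" and w: "w \<in> X j"
      then have i: "i < p" and j: "j < p" by auto
      have wi: "w \<notin> X i" using same[OF i j] w ij by blast
      \<comment> \<open>The given pair need not be consecutive in \<open>X i\<close>, so it is
        replaced by the neighbours of \<open>w\<close>. A separating point would lie between
        \<open>w\<close> and \<open>u0\<close> and between \<open>w\<close> and \<open>v0\<close>,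
        hence equal \<open>w\<close>, which is not in \<open>X i\<close>.\<close>
      obtain u v where u: "u \<in> X i" "u < w" and v: "v \<in> X i" "w < v"
        and adj: "\<And>b. b \<in> X i \<Longrightarrow> b \<le> u \<or> v \<le> b"
        using fin[OF i] ne[OF i]
      proof (cases rule: separating_point_or_neighbours[where t = w])
        case (point a)
        then have "a = w" using point(2)[OF u0(1)] point(2)[OF v0(1)] u0 v0 by linarith
        with point wi show ?thesis by blast
      next
        case (bridge u v)
        then show ?thesis using that by blast
      qed
      \<comment> \<open>The successor \<open>b\<close> of \<open>u\<close> in the whole data set
        satisfies \<open>b \<le> w\<close>, since \<open>w\<close> is a candidate; thus it comes
        before \<open>v\<close>.\<close>
      let ?R = "{b \<in> S. u < b}"
      define b where "b = Min ?R"
      have wR: "w \<in> ?R" using w u sub[OF j] by blast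
      have finR: "finite ?R" using S(1) by simp
      have bR: "b \<in> ?R" unfolding b_def using Min_in[OF finR] wR by blast
      have b_le: "b \<le> a" if "a \<in> ?R" for a unfolding b_def using Min_le[OF finR that] .
      have bv: "b < v" using b_le[OF wR] v by simp
      define t where "t = (u + b) / 2"
      have t: "u < t" "t < b" using bR by (auto simp: t_def)
      have c: "kriging_weights ?k S t (bridge_weight \<theta> t u b)"
        using b_le bR u sub[OF i] t by (intro kriging_weights_bridge[OF \<theta> S(1)]) force+
      have di: "kriging_weights ?k (X i) t (bridge_weight \<theta> t u v)"
        using u v t bv adj by (intro kriging_weights_bridge[OF \<theta> fin[OF i]]) auto
      have "\<exists>\<beta>. \<forall>i'<p. \<forall>a\<in>X i'. bridge_weight \<theta> t u b a
          = \<beta> i' * ((d t)(i := bridge_weight \<theta> t u v)) i' a"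
        using zero di d by (subst zero_iff[OF c, symmetric]) auto
      then obtain \<beta> where \<beta>: "bridge_weight \<theta> t u b a = \<beta> * bridge_weight \<theta> t u v a"
        if "a \<in> X i" for a using i by (metis fun_upd_same)
      have "bridge_weight \<theta> t u b v = 0"
        using t bv by (simp add: bridge_weight_def)
      then have "\<beta> = 0"
        using \<beta>[OF v(1)] bridge_weight_pos(2)[OF \<theta>, of u t v] t bv by simp
      then show False
        using \<beta>[OF u(1)] bridge_weight_pos(1)[OF \<theta>, of u t b] t by simp
    qed
  next
    assume perfect: "perfect_clustering p X"
    have no_between: False
      if "i < p" "j < p" "u \<in> X i" "v \<in> X i" "w \<in> X j" "u < w" "w < v" "w \<notin> X i" for i j u v w
    proof -
      have "i \<noteq> j" using that by blast
      then show False
        using perfect that unfolding perfect_clustering_def by (meson lessThan_iff)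
    qed
    show "\<forall>t. ?zero t"
    proof
      fix t
      \<comment> \<open>If the full weights live on one group and solve its normal equations, that
        group's predictor is the full one: factor 1 there, 0 elsewhere.\<close>
      have single: "?zero t" if i: "i < p" and c: "kriging_weights ?k S t c"
        and ci: "kriging_weights ?k (X i) t c" and supp: "\<And>a. a \<in> S - X i \<Longrightarrow> c a = 0" for i c
      proof -
        let ?d = "(d t)(i := c)" and ?\<beta> = "\<lambda>i'. if i' = i then 1 else 0"
        have "c a = ?\<beta> i' * ?d i' a" if "i' < p" "a \<in> X i'" for i' a
          using that same[OF i that(1) _ that(2)] supp[of a] sub[OF that(1)]
          by (cases "i' = i") auto
        moreover have "kriging_weights ?k (X i') t (?d i')" if "i' < p" for i'
          using ci d that by simp
        ultimately show ?thesis
          by (intro zero_iff[OF c, of ?d, THEN iffD2] exI[of _ ?\<beta>]) blast+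
      qed
      show "?zero t"
        using S
      proof (cases rule: separating_point_or_neighbours[where t = t])
        case (point a)
        then obtain i where i: "i < p" "a \<in> X i" using X by blast
        have c: "kriging_weights ?k S t (point_weight \<theta> t a)"
          by (rule kriging_weights_point[OF S(1) point])
        have ci: "kriging_weights ?k (X i) t (point_weight \<theta> t a)"
          by (rule kriging_weights_point[OF fin[OF i(1)] i(2) point(2)]) (use sub[OF i(1)] in blast)
        show ?thesis
          by (rule single[OF i(1) c ci]) (use i(2) in \<open>auto simp: point_weight_def\<close>)
      next
        case (bridge u v)
        obtain i where i: "i < p" "u \<in> X i" using X bridge(1) by blast
        obtain j where j: "j < p" "v \<in> X j" using X bridge(2) by blast
        let ?c = "bridge_weight \<theta> t u v"
        have c: "kriging_weights ?k S t ?c"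
          by (rule kriging_weights_bridge[OF \<theta> S(1) bridge])
        show ?thesis
        proof (cases "i = j")
          case True
          have ci: "kriging_weights ?k (X i) t ?c"
            using i j True bridge sub[OF i(1)] by (intro kriging_weights_bridge[OF \<theta> fin]) auto
          show ?thesis
            by (rule single[OF i(1) c ci]) (use i j True in \<open>auto simp: bridge_weight_def\<close>)
        next
          case False
          have vi: "v \<notin> X i" and uj: "u \<notin> X j" using same i j False by blast+
          \<comment> \<open>A point of \<open>X i\<close> beyond \<open>u\<close> would also lie
            beyond \<open>v\<close>, so that \<open>X i\<close> would enclose \<open>v\<close>, a
            point of another group.\<close>
          have left: "b \<le> u" if "b \<in> X i" for b
          proof (rule ccontr)
            assume "\<not> b \<le> u"
            then have "v \<le> b" using bridge(5) sub[OF i(1)] that by blast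
            moreover have "b \<noteq> v" using vi that by blast
            ultimately show False
              using no_between[OF i(1) j(1) i(2) that j(2)] vi bridge(3,4) by simp
          qed
          have right: "v \<le> b" if "b \<in> X j" for b
          proof (rule ccontr)
            assume "\<not> v \<le> b"
            then have "b \<le> u" using bridge(5) sub[OF j(1)] that by blast
            moreover have "b \<noteq> u" using uj that by blast
            ultimately show False
              using no_between[OF j(1) i(1) that j(2) i(2)] uj bridge(3,4) by simp
          qed
          let ?d = "(d t)(i := point_weight \<theta> t u, j := point_weight \<theta> t v)"
          \<comment> \<open>The full weights at \<open>u\<close> and \<open>v\<close> divided by the
            single-neighbour weights, which are positive exponentials. On the other groups the full
            weights vanish.\<close>
          let ?\<beta> = "\<lambda>i'. if i' = i then ?c u / point_weight \<theta> t u u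
            else if i' = j then ?c v / point_weight \<theta> t v v else 0"
          have wi: "kriging_weights ?k (X i) t (point_weight \<theta> t u)"
            using i left bridge(3) by (intro kriging_weights_point fin) force+
          have wj: "kriging_weights ?k (X j) t (point_weight \<theta> t v)"
            using j right bridge(4) by (intro kriging_weights_point fin) force+
          have "?c a = ?\<beta> i' * ?d i' a" if i': "i' < p" "a \<in> X i'" for i' a
          proof -
            consider "i' = i" | "i' = j" | "i' \<noteq> i" "i' \<noteq> j" by blast
            then show ?thesis
            proof cases
              case 1
              then show ?thesis using False vi i'(2)
                by (auto simp: bridge_weight_def point_weight_def)
            next
              case 2
              then show ?thesis using False uj i'(2) bridge(3,4)
                by (auto simp: bridge_weight_def point_weight_def)
            next
              case 3
              then have "a \<noteq> u" "a \<noteq> v" using same i j i' by blast+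
              then show ?thesis using 3 by (simp add: bridge_weight_def)
            qed
          qed
          moreover have "kriging_weights ?k (X i') t (?d i')" if "i' < p" for i'
            using wi wj d that by simp
          ultimately show ?thesis
            by (intro zero_iff[OF c, of ?d, THEN iffD2] exI[of _ ?\<beta>]) blast+
        qed
      qed
    qed
  qed
qed

end
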